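(* Let $\epsilon, \epsilon' > 0$ and $N \geq 1$ be real numbers. Let $\alpha$ be a real number and suppose there are integers $a$ and $q$ with $1 \leq q \leq N^{2 - \epsilon'}$, $\gcd(a,q) = 1$, and $\left|\alpha - \frac{a}{q}\right| \leq \frac{1}{q N^{2 - \epsilon'}}$. Then there exist integers $a_1, a_2, a_3$ and integers $1 \leq q_1, q_2, q_3 \leq N$ such that $$\left|\alpha - \frac{a_1}{q_1} - \frac{a_2}{q_2} - \frac{a_3}{q_3}\right| \leq \frac{C_\epsilon}{q N^{2 - \epsilon' - \epsilon}},$$ where $C_\epsilon>0$ is a constant depending only on $\epsilon$. *)

theory Defs
  imports Complex_Main
begin

end

theory Submission
  imports Defs "HOL-Computational_Algebra.Primes" "HOL-Analysis.Kronecker_Approximation_Theorem"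
begin

text \<open>
  Put \<open>\<epsilon> = 7\<delta>\<close> and \<open>K = \<lfloor>N\<^bsup>1 - \<delta>\<^esup>\<rfloor>\<close>. For primes \<open>p < r\<close> in \<open>(K, N]\<close>, Dirichlet's theorem yields
  \<open>x \<le> K\<close> and \<open>b\<close> such that \<open>\<rho> = a x p r - b q\<close> satisfies \<open>\<bar>\<rho>\<bar> \<le> q / K\<close>. As \<open>p\<close>, \<open>r\<close>, \<open>x\<close> are pairwise
  coprime, \<open>b / (p r x)\<close> is a sum of fractions with these denominators, and it lies within
  \<open>\<bar>\<rho>\<bar> / (q p r x)\<close> of \<open>a / q\<close>. This is good enough unless \<open>x\<close> is much smaller than \<open>\<bar>\<rho>\<bar>\<close>. In that case
  \<open>n = x p r\<close> is small; since \<open>\<rho>\<close> determines \<open>n\<close> modulo \<open>q\<close>, and \<open>n\<close> determines \<open>p\<close> and \<open>r\<close> as its only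
  prime factors above \<open>K\<close>, there are few such pairs. By Chebyshev's lower bound for the number of
  primes there are more pairs \<open>(p, r)\<close> than that.
\<close>

section \<open>Chebyshev's lower bound for the prime count, by way of lcm(1, ..., n)\<close>

text \<open>Each reciprocal \<open>1 / (Suc n * (n choose Suc m))\<close> is a difference of two
  such reciprocals with lower index \<open>m\<close>, from rows \<open>n - 1\<close> and
  \<open>n\<close>. By induction on \<open>m\<close>, multiplying it by the lcm therefore gives an
  integer.\<close>

lemma Suc_times_binomial_dvd_Lcm:
  assumes "n < K" "m \<le> n"
  shows "Suc n * (n choose m) dvd Lcm {1..K}"
  using assms
proof (induction m arbitrary: n)
  case 0
  then show ?case by (auto intro!: dvd_Lcm)
next
  case (Suc m)
  then obtain k where n: "n = Suc k" and mk: "m \<le> k" "k < K"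
    by (cases n) auto
  define D where "D = Lcm {1..K}"
  obtain u v where u: "D = Suc n * (n choose m) * u" and v: "D = Suc k * (k choose m) * v"
    using Suc.IH[of n] Suc.IH[of k] mk n Suc.prems unfolding D_def dvd_def by fastforce
  define x where "x = real (k choose m)"
  define y where "y = real (k choose Suc m)"
  define z where "z = real (n choose m)"
  have pos: "x > 0" "z > 0" "n choose Suc m > 0"
    using mk n by (auto simp: x_def z_def)
  have xy: "real (n choose Suc m) = x + y"
    by (simp add: n x_def y_def)
  have e1: "real (Suc m) * (x + y) = real n * x"
    using arg_cong[OF Suc_times_binomial[of m k, folded n], of real]
    unfolding of_nat_mult xy x_def[symmetric] .
  have e2: "real (n - m) * z = real n * x"
    using arg_cong[OF binomial_absorb_comp[of n m], of real]
    unfolding z_def x_def n of_nat_mult diff_Suc_1 .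
  have nm: "real (n - m) = real n - real m" using mk n by simp
  have w: "x + y > 0" using pos xy by linarith
  have "real D = real (Suc n) * z * u" unfolding u z_def of_nat_mult ..
  moreover have "real D = real n * x * v" unfolding v x_def n of_nat_mult ..
  ultimately have uv: "real (Suc n) * z * u = real n * x * v" "real D = real n * x * v" by simp_all
  \<comment> \<open>This is the recurrence of the Leibniz harmonic triangle.\<close>
  have key: "1 / (real (Suc n) * z) + 1 / (real (Suc n) * (x + y)) = 1 / (real n * x)"
  proof -
    have npos: "real n > 0" by (simp add: n)
    have "1 / z = (real n - real m) / (real n * x)"
      using e2 nm pos npos by (simp add: field_simps)
    moreover have "1 / (x + y) = real (Suc m) / (real n * x)"
      using e1 pos npos w by (simp add: field_simps)
    ultimately have "1 / z + 1 / (x + y) = real (Suc n) / (real n * x)"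
      by (simp add: add_divide_distrib[symmetric])
    then have "(1 / z + 1 / (x + y)) / real (Suc n) = 1 / (real n * x)"
      by simp
    then show ?thesis by (simp add: add_divide_distrib mult.commute)
  qed
  have "real D / (real (Suc n) * z) + real D / (real (Suc n) * (x + y)) = real D / (real n * x)"
    using arg_cong[OF key, of "\<lambda>t. real D * t"] by (simp add: distrib_left)
  moreover have "real D / (real (Suc n) * z) = u"
    unfolding uv(2) uv(1)[symmetric] using pos by (simp del: of_nat_Suc)
  moreover have "real D / (real n * x) = v" using uv pos n by simp
  ultimately have quot: "real D / (real (Suc n) * (x + y)) = real v - real u" by linarith
  \<comment> \<open>The sign ensures that the natural-number subtraction \<open>v - u\<close> is not
    truncated, so it can serve as the cofactor.\<close>
  then have "real v - real u \<ge> 0"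
    using w by (metis divide_nonneg_nonneg mult_nonneg_nonneg less_imp_le of_nat_0_le_iff)
  then have "real v - real u = real (v - u)" by simp
  moreover have "real (Suc n) * (x + y) \<noteq> 0" using w by (simp del: of_nat_Suc)
  ultimately have "real D = real (Suc n) * (x + y) * real (v - u)"
    using quot by (metis mult.commute nonzero_divide_eq_eq)
  then have "real D = real (Suc n * (n choose Suc m) * (v - u))"
    unfolding of_nat_mult xy .
  then have "D = Suc n * (n choose Suc m) * (v - u)" by (simp only: of_nat_eq_iff)
  then show ?case unfolding D_def by (metis dvd_triv_left)
qed

text \<open>Row \<open>n\<close> of Pascal's triangle sums to \<open>2 ^ n\<close>, and each of its
  \<open>n + 1\<close> entries, multiplied by \<open>n + 1\<close>, divides the lcm.\<close>

lemma Lcm_ge_power_of_2: "2 ^ n \<le> Lcm {1..Suc n}"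
proof -
  have "Suc n * 2 ^ n = (\<Sum>m\<le>n. Suc n * (n choose m))"
    by (simp only: choose_row_sum[symmetric] sum_distrib_left)
  also have "\<dots> \<le> (\<Sum>m\<le>n. Lcm {1..Suc n})"
    by (intro sum_mono dvd_imp_le[OF Suc_times_binomial_dvd_Lcm]) (auto simp: Lcm_0_iff intro!: Nat.gr0I)
  also have "\<dots> = Suc n * Lcm {1..Suc n}" by simp
  finally show ?thesis by (simp only: Suc_mult_le_cancel1)
qed

text \<open>The lcm divides the product over primes \<open>p \<le> n\<close> of the largest power of
  \<open>p\<close> dividing some \<open>m \<le> n\<close>. Each such power is itself at most
  \<open>n\<close>.\<close>

lemma Lcm_le_power_card_primes:
  fixes n :: nat
  assumes "n > 0"
  shows "Lcm {1..n} \<le> n ^ card {p. prime p \<and> p \<le> n}"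
proof -
  let ?P = "{p. prime p \<and> p \<le> n}"
  define e where "e p = Max (multiplicity p ` {1..n})" for p
  have e_ge: "multiplicity p m \<le> e p" if "m \<in> {1..n}" for p m
    unfolding e_def using that by (intro Max_ge) auto
  have fin: "finite ?P" by simp
  have pe: "p ^ e p \<le> n" for p
  proof -
    have "e p \<in> multiplicity p ` {1..n}"
      unfolding e_def using assms by (intro Max_in) auto
    then obtain m where m: "m \<in> {1..n}" "e p = multiplicity p m" by auto
    have "p ^ e p dvd m" unfolding m(2) by (rule multiplicity_dvd)
    then show ?thesis using m(1) by (auto dest!: dvd_imp_le)
  qed
  have prod_nz: "(\<Prod>p\<in>?P. p ^ e p) \<noteq> 0" by (auto dest: prime_gt_0_nat)
  have "m dvd (\<Prod>p\<in>?P. p ^ e p)" if m: "m \<in> {1..n}" for m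
  proof (rule multiplicity_le_imp_dvd)
    fix p :: nat assume p: "prime p"
    show "multiplicity p m \<le> multiplicity p (\<Prod>p\<in>?P. p ^ e p)"
    proof (cases "p \<le> n")
      case True
      then show ?thesis
        using e_ge[OF m, of p] p fin
        by (subst multiplicity_prod_prime_powers) auto
    next
      case False
      then have "\<not> p dvd m" using m by (auto dest: dvd_imp_le)
      then show ?thesis by (simp add: not_dvd_imp_multiplicity_0)
    qed
  qed (use m prod_nz in auto)
  then have "Lcm {1..n} dvd (\<Prod>p\<in>?P. p ^ e p)" by (rule Lcm_least)
  then have "Lcm {1..n} \<le> (\<Prod>p\<in>?P. p ^ e p)" using prod_nz by (intro dvd_imp_le) (simp_all only: neq0_conv)
  also have "\<dots> \<le> (\<Prod>p\<in>?P. n)" by (intro prod_mono) (use pe in auto)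
  finally show ?thesis by simp
qed

lemma card_primes_ge:
  assumes "n > 0"
  shows "(real n - 1) * ln 2 \<le> real (card {p::nat. prime p \<and> p \<le> n}) * ln (real n)"
proof -
  obtain k where k: "n = Suc k" using assms by (cases n) auto
  have "2 ^ k \<le> n ^ card {p::nat. prime p \<and> p \<le> n}"
    using Lcm_ge_power_of_2[of k] Lcm_le_power_card_primes[OF assms] unfolding k by (rule order_trans)
  then have "real (2 ^ k) \<le> real (n ^ card {p::nat. prime p \<and> p \<le> n})" by (simp only: of_nat_le_iff)
  then have "(2::real) ^ k \<le> real n ^ card {p::nat. prime p \<and> p \<le> n}" by simp
  then have "ln ((2::real) ^ k) \<le> ln (real n ^ card {p::nat. prime p \<and> p \<le> n})" using assms
    by (subst ln_le_cancel_iff) auto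
  then show ?thesis using assms k by (simp add: ln_realpow)
qed

section \<open>Partial fractions and two facts for counting pairs\<close>

lemma partial_fractions_three:
  fixes b x y z :: int
  assumes "coprime x y" "coprime x z" "coprime y z" "x > 0" "y > 0" "z > 0"
  obtains u v w where "real_of_int b / (of_int x * of_int y * of_int z) =
    of_int u / of_int x + of_int v / of_int y + of_int w / of_int z"
proof -
  have "coprime (x * y) z" using assms by simp
  then obtain s t where st: "s * (x * y) + t * z = 1"
    by (metis bezout_int coprime_imp_gcd_eq_1)
  obtain s' t' where st': "s' * x + t' * y = 1"
    using assms(1) by (metis bezout_int coprime_imp_gcd_eq_1)
  \<comment> \<open>Inserting the second Bezout identity into the \<open>t * z\<close> term leaves
    three terms, each divisible by two of the three denominators.\<close>
  have "b = b * (s * (x * y) + t * z * (s' * x + t' * y))" using st st' by simp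
  also have "\<dots> = (b * t * t') * (y * z) + (b * t * s') * (x * z) + (b * s) * (x * y)"
    by (simp add: algebra_simps)
  finally have "real_of_int b = of_int ((b * t * t') * (y * z) + (b * t * s') * (x * z) + (b * s) * (x * y))"
    by (rule arg_cong)
  then have "real_of_int b / (of_int x * of_int y * of_int z) =
    of_int (b * t * t') / of_int x + of_int (b * t * s') / of_int y + of_int (b * s) / of_int z"
    using assms(4-6) by (simp add: field_simps)
  then show ?thesis by (rule that)
qed

lemma card_increasing_pairs:
  fixes S :: "'a::linorder set"
  assumes "finite S"
  shows "2 * card {(x, y). x \<in> S \<and> y \<in> S \<and> x < y} = card S * (card S - 1)"
proof -
  let ?L = "{(x, y). x \<in> S \<and> y \<in> S \<and> x < y}"
  let ?G = "{(x, y). x \<in> S \<and> y \<in> S \<and> y < x}"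
  let ?E = "(\<lambda>x. (x, x)) ` S"
  have fin: "finite ?L" "finite ?G" using assms
    by (auto intro: finite_subset[of _ "S \<times> S"])
  have "?G = prod.swap ` ?L" by auto
  then have G: "card ?G = card ?L" by (simp add: card_image)
  have E: "card ?E = card S" by (intro card_image inj_onI) auto
  have "S \<times> S = (?L \<union> ?G) \<union> ?E" by (auto simp: image_iff)
  then have "card S * card S = card ((?L \<union> ?G) \<union> ?E)" by (simp add: card_cartesian_product[symmetric])
  also have "\<dots> = card ?L + card ?G + card ?E"
  proof -
    have "(?L \<union> ?G) \<inter> ?E = {}" "?L \<inter> ?G = {}" by auto
    then show ?thesis using fin assms by (simp add: card_Un_disjoint)
  qed
  finally show ?thesis using G E by (simp add: algebra_simps)
qed

text \<open>A prime above \<open>K\<close> cannot divide the cofactor, which is at most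
  \<open>K\<close>. So \<open>p\<close> and \<open>r\<close> are the only primes above
  \<open>K\<close> dividing the product, and \<open>p < r\<close> fixes their order.\<close>

lemma prime_pair_cofactor_unique:
  fixes p p' r r' x x' K :: nat
  assumes "prime p" "prime r" "p < r" "K < p" "0 < x" "x \<le> K"
    and "prime p'" "prime r'" "p' < r'" "K < p'" "0 < x'" "x' \<le> K"
    and eq: "x * p * r = x' * p' * r'"
  shows "p = p' \<and> r = r'"
proof -
  have *: "s = p \<or> s = r"
    if "prime s" "s dvd x * p * r" "K < s" "0 < x" "x \<le> K" "prime p" "prime r" for s x p r :: nat
    using that by (auto simp: prime_dvd_mult_iff dest: dvd_imp_le primes_dvd_imp_eq)
  have "p = p' \<or> p = r'" "r = p' \<or> r = r'"
    using assms *[of p x' p' r'] *[of r x' p' r'] by (auto simp: eq[symmetric])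
  then show ?thesis using assms by auto
qed

section \<open>Dirichlet approximation combined with the pigeonhole principle\<close>

text \<open>If every pair failed, the pairs would inject into a box of integer points whose size is
  at most the left side of \<open>many\<close>.\<close>

lemma exists_prime_pair_with_good_multiple:
  fixes a q :: int and K :: nat and N T :: real and S :: "nat set"
  assumes q: "q > 0" and aq: "coprime a q" and K: "K > 0" and T: "T > 0" and S: "finite S"
    and primes: "\<And>p. p \<in> S \<Longrightarrow> prime p \<and> K < p \<and> real p \<le> N"
    and many: "(2 * of_int q / K + 1) * (N\<^sup>2 / (K * T) + 1)
                 < real (card {(p, r). p \<in> S \<and> r \<in> S \<and> p < r})"
  obtains p r x :: nat and b :: int
    where "p \<in> S" "r \<in> S" "p < r" "0 < x" "x \<le> K"
      "\<bar>of_int a * (real x * real p * real r) - of_int b * of_int q\<bar> \<le> T * real x"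
proof -
  let ?pairs = "{(p, r). p \<in> S \<and> r \<in> S \<and> p < r}"
  \<comment> \<open>Dirichlet's theorem for \<open>a p r / q\<close> with denominators up to
    \<open>K\<close>, multiplied through by \<open>q\<close>. Quantifying over all \<open>z\<close>
    lets \<open>x\<close> and \<open>b\<close> be chosen as functions of the pair.\<close>
  have "\<exists>x b. 0 < x \<and> x \<le> K \<and>
      \<bar>of_int a * (real x * real (fst z) * real (snd z)) - of_int b * of_int q\<bar> \<le> of_int q / K" for z :: "nat \<times> nat"
  proof -
    let ?\<theta> = "of_int a * real (fst z) * real (snd z) / of_int q"
    obtain h k where k: "0 < k" "k \<le> int K" "\<bar>of_int k * ?\<theta> - of_int h\<bar> < 1 / K"
      using Dirichlet_approx[OF K] .
    have "\<bar>of_int a * (real (nat k) * real (fst z) * real (snd z)) - of_int h * of_int q\<bar>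
        = of_int q * \<bar>of_int k * ?\<theta> - of_int h\<bar>"
    proof -
      have "of_int a * (real (nat k) * real (fst z) * real (snd z)) - of_int h * of_int q
        = of_int q * (of_int k * ?\<theta> - of_int h)"
        using q k(1) by (simp add: field_simps)
      then show ?thesis using q by (simp add: abs_mult)
    qed
    also have "\<dots> \<le> of_int q * (1 / K)" using q k(3) by (intro mult_left_mono) auto
    finally show ?thesis using k by (intro exI[of _ "nat k"] exI[of _ h]) auto
  qed
  then obtain x b where x: "\<And>z. 0 < x z" "\<And>z. x z \<le> K"
    and b: "\<And>z. \<bar>of_int a * (real (x z) * real (fst z) * real (snd z)) - of_int (b z) * of_int q\<bar> \<le> of_int q / K"
    by metis
  define n where "n z = x z * fst z * snd z" for z
  define \<rho> where "\<rho> z = a * int (n z) - b z * q" for z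
  have \<rho>_real: "of_int (\<rho> z) = of_int a * (real (x z) * real (fst z) * real (snd z)) - of_int (b z) * of_int q" for z
    by (simp add: \<rho>_def n_def)
  have \<rho>_le: "\<bar>of_int (\<rho> z)\<bar> \<le> of_int q / real K" for z
    using b[of z] by (simp only: \<rho>_real)
  show ?thesis
  proof (cases "\<exists>z\<in>?pairs. \<bar>of_int (\<rho> z)\<bar> \<le> T * real (x z)")
    case True
    then obtain z where "z \<in> ?pairs" "\<bar>of_int (\<rho> z)\<bar> \<le> T * real (x z)" by blast
    then show ?thesis using x by (intro that[of "fst z" "snd z" "x z" "b z"]) (auto simp: \<rho>_real)
  next
    case False
    let ?R = "\<lfloor>of_int q / real K\<rfloor>" and ?B = "\<lfloor>N\<^sup>2 / (K * T)\<rfloor>"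
    \<comment> \<open>Since \<open>a\<close> is invertible modulo \<open>q\<close>, the first
      component fixes the residue of \<open>n z\<close> modulo \<open>q\<close>; the second fixes
      the quotient. Together they determine \<open>n z\<close>, hence the pair.\<close>
    let ?f = "\<lambda>z. (\<rho> z, int (n z) div q)"
    \<comment> \<open>Failure forces \<open>T * x < q / K\<close>, so \<open>x\<close> is below
      \<open>q / (K * T)\<close>, while \<open>p * r\<close> is at most
      \<open>N\<^sup>2\<close>.\<close>
    have n_less: "of_int (int (n z) div q) \<le> N\<^sup>2 / (K * T)" if z: "z \<in> ?pairs" for z
    proof -
      have "T * real (x z) < \<bar>of_int (\<rho> z)\<bar>" using False z by (meson not_le)
      also note \<rho>_le[of z]
      finally have xz: "real (x z) \<le> of_int q / (K * T)"
        using K T by (simp add: field_simps)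
      have "real (fst z) * real (snd z) \<le> N * N"
        using z primes by (intro mult_mono) (auto intro: order_trans[OF of_nat_0_le_iff])
      then have "real (x z) * (real (fst z) * real (snd z)) \<le> of_int q / (K * T) * (N * N)"
        using xz q K T by (intro mult_mono[of "real (x z)"]) auto
      then have "real (n z) \<le> of_int q * (N\<^sup>2 / (K * T))"
        by (simp add: n_def power2_eq_square mult_ac)
      then have "real (n z) / of_int q \<le> N\<^sup>2 / (K * T)"
        using q by (simp add: field_simps)
      moreover have "of_int (int (n z) div q) \<le> real (n z) / of_int q"
        using real_of_int_div4[of "int (n z)" q] by simp
      ultimately show ?thesis by linarith
    qed
    have "inj_on ?f ?pairs"
    proof (rule inj_onI)
      fix z z' assume z: "z \<in> ?pairs" "z' \<in> ?pairs" and eq: "?f z = ?f z'"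
      have "a * (int (n z) - int (n z')) = (b z - b z') * q"
        using eq by (simp add: \<rho>_def algebra_simps)
      then have "q dvd a * (int (n z) - int (n z'))" by simp
      then have "q dvd int (n z) - int (n z')"
        using aq by (simp add: coprime_dvd_mult_right_iff coprime_commute)
      then have "int (n z) mod q = int (n z') mod q" by (simp add: mod_eq_dvd_iff)
      moreover have "int (n z) div q = int (n z') div q" using eq by simp
      ultimately have "int (n z) = int (n z')" by (metis div_mult_mod_eq)
      then have "x z * fst z * snd z = x z' * fst z' * snd z'" by (simp only: n_def of_nat_eq_iff)
      then have "fst z = fst z' \<and> snd z = snd z'"
        using z primes x by (intro prime_pair_cofactor_unique[of _ _ K]) auto
      then show "z = z'" by (simp add: prod_eq_iff)
    qed
    moreover have "?f ` ?pairs \<subseteq> {-?R..?R} \<times> {0..?B}"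
    proof (intro image_subsetI SigmaI)
      fix z assume z: "z \<in> ?pairs"
      have "\<bar>\<rho> z\<bar> \<le> ?R" using \<rho>_le[of z] by (simp add: le_floor_iff)
      then show "\<rho> z \<in> {-?R..?R}" by auto
      show "int (n z) div q \<in> {0..?B}" using n_less[OF z] q
        by (simp add: le_floor_iff pos_imp_zdiv_nonneg_iff)
    qed
    ultimately have "card ?pairs \<le> card ({-?R..?R} \<times> {0..?B})"
      by (intro card_inj_on_le) auto
    also have "\<dots> = nat (2 * ?R + 1) * nat (?B + 1)" by simp
    finally have "real (card ?pairs) \<le> real (nat (2 * ?R + 1) * nat (?B + 1))" by (simp only: of_nat_le_iff)
    also have "\<dots> = of_int (2 * ?R + 1) * of_int (?B + 1)" using q K T by simp
    also have "\<dots> \<le> (2 * of_int q / K + 1) * (N\<^sup>2 / (K * T) + 1)"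
    proof (rule mult_mono)
      have "of_int ?R \<le> of_int q / real K" by simp
      then have "2 * of_int ?R \<le> 2 * (of_int q / real K)" by (rule mult_left_mono) simp
      then show "of_int (2 * ?R + 1) \<le> 2 * of_int q / real K + 1" by simp
    qed (use q K T in auto)
    finally show ?thesis using many by simp
  qed
qed

section \<open>Choice of parameters for large \<open>N\<close>\<close>

text \<open>Chebyshev's bound eventually exceeds twice \<open>N powr (1 - \<delta>)\<close>, and at
  most \<open>N powr (1 - \<delta>)\<close> primes are lost by discarding those up to the
  cutoff.\<close>

lemma eventually_many_primes:
  fixes \<delta> :: real
  assumes "\<delta> > 0"
  shows "eventually (\<lambda>N::real. N powr (1 - \<delta>) \<le>
    real (card {p::nat. prime p \<and> nat \<lfloor>N powr (1 - \<delta>)\<rfloor> < p \<and> real p \<le> N})) at_top"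
proof -
  \<comment> \<open>One unit of \<open>N - 2\<close> pays for rounding \<open>N\<close> down to
    \<open>n\<close>, the other is the \<open>n - 1\<close> in
    \<open>card_primes_ge\<close>.\<close>
  have "eventually (\<lambda>N::real. 2 * N powr (1 - \<delta>) * ln N \<le> (N - 2) * ln 2) at_top"
    using assms by real_asymp
  then show ?thesis using eventually_gt_at_top[of "2::real"]
  proof eventually_elim
    case (elim N)
    define n K where "n = nat \<lfloor>N\<rfloor>" and "K = nat \<lfloor>N powr (1 - \<delta>)\<rfloor>"
    let ?P = "{p::nat. prime p \<and> p \<le> n}" and ?Q = "{p::nat. prime p \<and> K < p \<and> real p \<le> N}"
    have n: "n > 0" "real n \<le> N" "N < real n + 1"
      using elim by (auto simp: n_def)
    have Q: "?Q = {p. prime p \<and> K < p \<and> p \<le> n}"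
      using elim by (auto simp: n_def le_nat_iff le_floor_iff)
    have "card ?P \<le> card ({1..K} \<union> ?Q)"
      unfolding Q by (intro card_mono) (auto simp: Suc_le_eq prime_gt_0_nat)
    also have "\<dots> \<le> K + card ?Q" using card_Un_le[of "{1..K}" ?Q] by simp
    finally have "real (card ?P) \<le> real K + real (card ?Q)" by linarith
    moreover have "real K \<le> N powr (1 - \<delta>)" by (simp add: K_def)
    moreover have "2 * N powr (1 - \<delta>) \<le> real (card ?P)"
    proof -
      have "2 * N powr (1 - \<delta>) * ln N \<le> (N - 2) * ln 2" by fact
      also have "\<dots> \<le> (real n - 1) * ln 2" using n by (intro mult_right_mono) auto
      also have "\<dots> \<le> real (card ?P) * ln (real n)" using n by (intro card_primes_ge)
      also have "\<dots> \<le> real (card ?P) * ln N" using n by (intro mult_left_mono) auto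
      finally show ?thesis using elim by simp
    qed
    ultimately have "N powr (1 - \<delta>) \<le> real (card ?Q)" by linarith
    then show ?case by (simp only: K_def)
  qed
qed

lemma eventually_approx_by_three_fractions:
  fixes \<delta> :: real
  assumes \<delta>: "0 < \<delta>" "\<delta> \<le> 1 / 7"
  shows "eventually (\<lambda>N::real. \<forall>a q::int. 0 < q \<longrightarrow> of_int q \<le> N\<^sup>2 \<longrightarrow> coprime a q \<longrightarrow>
    (\<exists>(a1::int) (a2::int) (a3::int) (q1::int) (q2::int) (q3::int).
       1 \<le> q1 \<and> real_of_int q1 \<le> N \<and> 1 \<le> q2 \<and> real_of_int q2 \<le> N \<and> 1 \<le> q3 \<and> real_of_int q3 \<le> N \<and>
       \<bar>real_of_int a / real_of_int q - (real_of_int a1 / real_of_int q1 + real_of_int a2 / real_of_int q2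
          + real_of_int a3 / real_of_int q3)\<bar> \<le> N powr (7 * \<delta>) / (real_of_int q * N\<^sup>2))) at_top"
proof -
  \<comment> \<open>Here 60 = 5 * 3 * 4: the box sides contribute the constants 5 and 3, and the
    number of pairs is at least \<open>X * X / 4\<close>.\<close>
  have "eventually (\<lambda>N::real. N powr \<delta> > 60) at_top" using \<delta> by real_asymp
  moreover have "eventually (\<lambda>N::real. N powr (1 - \<delta>) \<ge> 2) at_top"
  proof -
    have "1 - \<delta> > 0" using \<delta> by simp
    then show ?thesis by real_asymp
  qed
  ultimately show ?thesis
    using eventually_many_primes[OF \<delta>(1)] eventually_gt_at_top[of "1::real"]
  proof eventually_elim
    case (elim N)
    \<comment> \<open>With \<open>T = N powr (5 * \<delta>)\<close> the box has order
      \<open>N powr (2 - 3 * \<delta>)\<close>, a factor \<open>N powr \<delta>\<close> below the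
      order \<open>X * X\<close> of the pair count. The final error \<open>T / (q * X * X)\<close>
      then costs exactly \<open>7 * \<delta>\<close> in the exponent.\<close>
    define X K S T where "X = N powr (1 - \<delta>)" and "K = nat \<lfloor>X\<rfloor>"
      and "S = {p::nat. prime p \<and> K < p \<and> real p \<le> N}" and "T = N powr (5 * \<delta>)"
    have N: "N > 1" and X2: "X \<ge> 2" and XS: "X \<le> real (card S)" and N60: "N powr \<delta> > 60"
      using elim by (simp_all add: X_def K_def S_def)
    have XN: "X \<le> N" using N \<delta> powr_mono[of "1 - \<delta>" 1 N] by (simp add: X_def)
    have K: "X / 2 \<le> real K" "real K \<le> X" "X < real K + 1" "K > 0"
      using X2 unfolding K_def by linarith+
    have T: "T > 0" using N by (simp add: T_def)
    have X_sq: "X * X = N powr (2 - 2 * \<delta>)"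
      by (simp add: X_def powr_add[symmetric])
    have N_sq: "N\<^sup>2 = N powr 2" using N by simp
    have finS: "finite S"
      by (rule finite_subset[of _ "{..nat \<lfloor>N\<rfloor>}"]) (auto simp: S_def le_nat_iff le_floor_iff)
    show ?case
    proof (intro allI impI)
      fix a q :: int assume q: "0 < q" "of_int q \<le> N\<^sup>2" and aq: "coprime a q"
      have "(2 * of_int q / K + 1) * (N\<^sup>2 / (K * T) + 1) \<le> (5 * N powr (1 + \<delta>)) * (3 * N powr (1 - 4 * \<delta>))"
      proof (rule mult_mono)
        have "2 * of_int q / K \<le> 2 * N\<^sup>2 / (X / 2)"
          using q K X2 by (intro frac_le) auto
        also have "\<dots> = 4 * N powr (1 + \<delta>)"
          using N by (simp add: N_sq X_def powr_diff powr_add field_simps power2_eq_square)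
        finally show "2 * of_int q / K + 1 \<le> 5 * N powr (1 + \<delta>)"
          using ge_one_powr_ge_zero[of N "1 + \<delta>"] N \<delta> by linarith
        \<comment> \<open>The summand 1 is absorbed below because \<open>1 - 4 * \<delta>\<close> is
          nonnegative, which follows from \<open>\<delta> \<le> 1 / 7\<close>.\<close>
        have "N\<^sup>2 / (K * T) \<le> N\<^sup>2 / (X / 2 * T)"
          using K X2 T by (intro divide_left_mono mult_right_mono mult_pos_pos) auto
        also have "\<dots> = 2 * (N powr 2 / (N powr (1 - \<delta>) * N powr (5 * \<delta>)))"
          unfolding N_sq X_def T_def by simp
        also have "\<dots> = 2 * N powr (1 - 4 * \<delta>)"
          by (simp only: powr_add[symmetric] powr_diff[symmetric]) simp
        finally show "N\<^sup>2 / (K * T) + 1 \<le> 3 * N powr (1 - 4 * \<delta>)"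
          using ge_one_powr_ge_zero[of N "1 - 4 * \<delta>"] N \<delta> by linarith
      qed (use K T in auto)
      also have "\<dots> = 60 * N powr (2 - 3 * \<delta>) / 4"
        by (simp add: powr_add[symmetric])
      also have "\<dots> < N powr \<delta> * N powr (2 - 3 * \<delta>) / 4"
        using N60 N by (intro divide_strict_right_mono mult_strict_right_mono) auto
      also have "\<dots> = X * X / 4" unfolding X_sq by (simp add: powr_add[symmetric])
      also have "\<dots> \<le> X * (X - 1) / 2" using X2 by (simp add: field_simps)
      also have "\<dots> \<le> real (card S) * (real (card S) - 1) / 2"
        using XS X2 by (intro divide_right_mono mult_mono) auto
      also have "\<dots> = real (card {(p, r). p \<in> S \<and> r \<in> S \<and> p < r})"
      proof -
        have "1 \<le> card S" using XS X2 by linarith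
        then show ?thesis
          using arg_cong[OF card_increasing_pairs[OF finS], of real] by (simp add: of_nat_diff)
      qed
      finally have many: "(2 * of_int q / K + 1) * (N\<^sup>2 / (K * T) + 1)
          < real (card {(p, r). p \<in> S \<and> r \<in> S \<and> p < r})" .
      have "\<And>p. p \<in> S \<Longrightarrow> prime p \<and> K < p \<and> real p \<le> N" by (simp add: S_def)
      from exists_prime_pair_with_good_multiple[OF q(1) aq K(4) T finS this many]
      obtain p r x :: nat and b :: int
        where pr: "p \<in> S" "r \<in> S" "p < r" and x: "0 < x" "x \<le> K"
          and b: "\<bar>of_int a * (real x * real p * real r) - of_int b * of_int q\<bar> \<le> T * real x"
        .
      have p: "prime p" "K < p" "real p \<le> N" and r: "prime r" "K < r" "real r \<le> N"
        using pr by (auto simp: S_def)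
      have "coprime p r" using p r pr by (simp add: primes_coprime)
      moreover have "coprime p x" "coprime r x"
        using p r x by (auto intro!: prime_imp_coprime dest!: dvd_imp_le)
      ultimately obtain u v w where uvw:
        "real_of_int b / (of_int (int p) * of_int (int r) * of_int (int x)) =
          of_int u / of_int (int p) + of_int v / of_int (int r) + of_int w / of_int (int x)"
        using partial_fractions_three[of "int p" "int r" "int x" b] p r x by auto
      have pos: "real p > 0" "real r > 0" "real x > 0" "real_of_int q > 0"
        using p r x q by (auto simp: prime_gt_0_nat)
      have "\<bar>of_int a / of_int q - of_int b / (real p * real r * real x)\<bar>
        = \<bar>of_int a * (real x * real p * real r) - of_int b * of_int q\<bar> / (of_int q * (real p * real r * real x))"
      proof -
        have "of_int a / of_int q - of_int b / (real p * real r * real x)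
          = (of_int a * (real x * real p * real r) - of_int b * of_int q) / (of_int q * (real p * real r * real x))"
          using pos by (simp add: field_simps)
        then show ?thesis using pos by (simp add: abs_mult)
      qed
      also have "\<dots> \<le> T * real x / (of_int q * (real p * real r * real x))"
        using b pos by (intro divide_right_mono) auto
      also have "\<dots> = T / (of_int q * (real p * real r))"
        using pos by (simp add: field_simps)
      \<comment> \<open>Both primes are integers above \<open>K\<close>, so they are at least
        \<open>K + 1\<close>, which exceeds \<open>X\<close>; the floor costs nothing here.\<close>
      also have "\<dots> \<le> T / (of_int q * (X * X))"
        using pos p r K X2 T by (intro divide_left_mono mult_left_mono mult_mono mult_pos_pos) auto
      also have "\<dots> = N powr (5 * \<delta>) / N powr (2 - 2 * \<delta>) / of_int q"
        by (simp add: X_sq T_def mult.commute)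
      also have "N powr (5 * \<delta>) / N powr (2 - 2 * \<delta>) = N powr (7 * \<delta>) / N\<^sup>2"
        unfolding N_sq powr_diff[symmetric] by simp
      finally have fin: "\<bar>of_int a / of_int q - of_int b / (real p * real r * real x)\<bar>
          \<le> N powr (7 * \<delta>) / (of_int q * N\<^sup>2)"
        by (simp add: mult.commute)
      have "\<bar>of_int a / of_int q - (of_int u / of_int (int p) + of_int v / of_int (int r)
          + of_int w / of_int (int x))\<bar> \<le> N powr (7 * \<delta>) / (of_int q * N\<^sup>2)"
        using fin unfolding uvw[symmetric] by simp
      moreover have "1 \<le> int p" "1 \<le> int r" "1 \<le> int x"
        and "of_int (int p) \<le> N" "of_int (int r) \<le> N" "of_int (int x) \<le> N"
        using p r x pos K XN by simp_all
      ultimately show "\<exists>(a1::int) (a2::int) (a3::int) (q1::int) (q2::int) (q3::int).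
       1 \<le> q1 \<and> real_of_int q1 \<le> N \<and> 1 \<le> q2 \<and> real_of_int q2 \<le> N \<and> 1 \<le> q3 \<and> real_of_int q3 \<le> N \<and>
       \<bar>real_of_int a / real_of_int q - (real_of_int a1 / real_of_int q1 + real_of_int a2 / real_of_int q2
          + real_of_int a3 / real_of_int q3)\<bar> \<le> N powr (7 * \<delta>) / (real_of_int q * N\<^sup>2)"
        by blast
    qed
  qed
qed

section \<open>Passage from \<open>a / q\<close> to \<open>\<alpha>\<close>, and small
  \<open>N\<close>\<close>

theorem theorem3:
  fixes \<epsilon> :: real
  assumes "\<epsilon> > 0"
  shows "\<exists>C::real. C > 0 \<and>
    (\<forall>(\<epsilon>'::real) (N::real) (\<alpha>::real) (a::int) (q::int).
       \<epsilon>' > 0 \<longrightarrow> N \<ge> 1 \<longrightarrow>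
       1 \<le> q \<longrightarrow> real_of_int q \<le> N powr (2 - \<epsilon>') \<longrightarrow>
       gcd a q = 1 \<longrightarrow>
       \<bar>\<alpha> - real_of_int a / real_of_int q\<bar> \<le> 1 / (real_of_int q * N powr (2 - \<epsilon>')) \<longrightarrow>
       (\<exists>(a1::int) (a2::int) (a3::int) (q1::int) (q2::int) (q3::int).
          1 \<le> q1 \<and> real_of_int q1 \<le> N \<and>
          1 \<le> q2 \<and> real_of_int q2 \<le> N \<and>
          1 \<le> q3 \<and> real_of_int q3 \<le> N \<and>
          \<bar>\<alpha> - real_of_int a1 / real_of_int q1 - real_of_int a2 / real_of_int q2
             - real_of_int a3 / real_of_int q3\<bar>
            \<le> C / (real_of_int q * N powr (2 - \<epsilon>' - \<epsilon>))))"
proof -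
  \<comment> \<open>The minimum with 1 keeps \<open>\<delta> \<le> 1 / 7\<close> even for large
    \<open>\<epsilon>\<close>.\<close>
  define \<delta> where "\<delta> = min \<epsilon> 1 / 7"
  have \<delta>: "0 < \<delta>" "\<delta> \<le> 1 / 7" "7 * \<delta> \<le> \<epsilon>" using assms by (auto simp: \<delta>_def)
  obtain N0 where N0: "\<And>N a q. N \<ge> N0 \<Longrightarrow> 0 < q \<Longrightarrow> of_int q \<le> N\<^sup>2 \<Longrightarrow> coprime a q \<Longrightarrow>
    (\<exists>(a1::int) (a2::int) (a3::int) (q1::int) (q2::int) (q3::int).
       1 \<le> q1 \<and> real_of_int q1 \<le> N \<and> 1 \<le> q2 \<and> real_of_int q2 \<le> N \<and> 1 \<le> q3 \<and> real_of_int q3 \<le> N \<and>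
       \<bar>real_of_int a / real_of_int q - (real_of_int a1 / real_of_int q1 + real_of_int a2 / real_of_int q2
          + real_of_int a3 / real_of_int q3)\<bar> \<le> N powr (7 * \<delta>) / (real_of_int q * N\<^sup>2))"
    using eventually_approx_by_three_fractions[OF \<delta>(1,2)] unfolding eventually_at_top_linorder by blast
  \<comment> \<open>The 2 covers the two error terms of the triangle inequality when
    \<open>N \<ge> N0\<close>; \<open>N0 ^ 4\<close> makes the allowed error at least 1 when
    \<open>N < N0\<close>. The even power keeps \<open>C \<ge> 2\<close> whatever the sign of
    \<open>N0\<close>, which depends only on \<open>\<delta>\<close>.\<close>
  define C where "C = 2 + N0 ^ 4"
  have C: "C \<ge> 2" by (simp add: C_def)
  show ?thesis
  proof (intro exI[of _ C] conjI allI impI)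
    fix \<epsilon>' N \<alpha> :: real and a q :: int
    assume \<epsilon>': "\<epsilon>' > 0" and N: "N \<ge> 1" and q: "1 \<le> q" "real_of_int q \<le> N powr (2 - \<epsilon>')"
      and aq: "gcd a q = 1"
      and \<alpha>: "\<bar>\<alpha> - real_of_int a / real_of_int q\<bar> \<le> 1 / (real_of_int q * N powr (2 - \<epsilon>'))"
    have le_N_sq: "N powr (2 - s) \<le> N\<^sup>2" if "s \<ge> 0" for s
      using powr_mono[of "2 - s" 2 N] N that by simp
    have q_le: "of_int q \<le> N\<^sup>2" using q le_N_sq[of \<epsilon>'] \<epsilon>' by linarith
    let ?E = "C / (real_of_int q * N powr (2 - \<epsilon>' - \<epsilon>))"
    show "\<exists>(a1::int) (a2::int) (a3::int) (q1::int) (q2::int) (q3::int).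
          1 \<le> q1 \<and> real_of_int q1 \<le> N \<and>
          1 \<le> q2 \<and> real_of_int q2 \<le> N \<and>
          1 \<le> q3 \<and> real_of_int q3 \<le> N \<and>
          \<bar>\<alpha> - real_of_int a1 / real_of_int q1 - real_of_int a2 / real_of_int q2
             - real_of_int a3 / real_of_int q3\<bar> \<le> ?E"
    proof (cases "N \<ge> N0")
      case True
      obtain a1 a2 a3 q1 q2 q3 :: int where bounds:
          "1 \<le> q1" "real_of_int q1 \<le> N" "1 \<le> q2" "real_of_int q2 \<le> N" "1 \<le> q3" "real_of_int q3 \<le> N"
        and approx: "\<bar>real_of_int a / real_of_int q - (real_of_int a1 / real_of_int q1
            + real_of_int a2 / real_of_int q2 + real_of_int a3 / real_of_int q3)\<bar>
          \<le> N powr (7 * \<delta>) / (real_of_int q * N\<^sup>2)"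
        using N0[OF True, of q a] q q_le aq by (auto simp: coprime_iff_gcd_eq_1)
      have "N powr (7 * \<delta>) / (of_int q * N\<^sup>2) \<le> N powr \<epsilon> / (of_int q * N powr (2 - \<epsilon>'))"
        using N q \<delta> \<epsilon>' by (intro frac_le mult_left_mono le_N_sq powr_mono) auto
      moreover have "1 / (of_int q * N powr (2 - \<epsilon>')) \<le> N powr \<epsilon> / (of_int q * N powr (2 - \<epsilon>'))"
        using N q assms by (intro divide_right_mono ge_one_powr_ge_zero) auto
      ultimately have "\<bar>\<alpha> - real_of_int a1 / real_of_int q1 - real_of_int a2 / real_of_int q2
             - real_of_int a3 / real_of_int q3\<bar> \<le> 2 * (N powr \<epsilon> / (of_int q * N powr (2 - \<epsilon>')))"
        using \<alpha> approx by linarith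
      also have "\<dots> = 2 / (of_int q * N powr (2 - \<epsilon>' - \<epsilon>))"
        by (simp add: powr_diff)
      also have "\<dots> \<le> ?E" using C q by (intro divide_right_mono) auto
      finally show ?thesis using bounds by blast
    next
      case False
      \<comment> \<open>For bounded \<open>N\<close> the allowed error is at least 1, so the floor
        of \<open>\<alpha>\<close> with all denominators 1 suffices.\<close>
      have "of_int q * N powr (2 - \<epsilon>' - \<epsilon>) \<le> N\<^sup>2 * N\<^sup>2"
        using q_le le_N_sq[of "\<epsilon>' + \<epsilon>"] \<epsilon>' assms by (intro mult_mono) (auto simp: diff_diff_eq)
      also have "\<dots> = N ^ 4" by (simp flip: power_add)
      also have "\<dots> \<le> N0 ^ 4" using False N by (intro power_mono) auto
      also have "\<dots> \<le> C" by (simp add: C_def)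
      finally have "1 \<le> ?E" using q N by simp
      moreover have "\<bar>\<alpha> - of_int \<lfloor>\<alpha>\<rfloor>\<bar> \<le> 1" by linarith
      ultimately show ?thesis using N
        by (intro exI[of _ "\<lfloor>\<alpha>\<rfloor>"] exI[of _ 0] exI[of _ 1]) auto
    qed
  qed (use C in auto)
qed

end
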